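(* Let $V=V^{(1)}\otimes\cdots\otimes V^{(d)}$ be a tensor product of finite dimensional complex Hilbert spaces. If $T\in V$ is a tensor, $\mathbf{S}=(S_1,\dots,S_r)$ is an $r$-tuple of tensors in $V$, and $\alpha\geq 1$ is real, then $$\Big(\sum_{i=1}^r |\langle T,S_i\rangle|^\alpha\Big)^{1/\alpha}\leq \|T\|_\star\,[\mathbf{S}]_\alpha .$$
   Context: $V$ carries the Hilbert space structure with $\langle v^{(1)}\otimes\cdots\otimes v^{(d)},w^{(1)}\otimes\cdots\otimes w^{(d)}\rangle=\prod_e\langle v^{(e)},w^{(e)}\rangle$. A pure tensor in $V$ is an element of the form $v^{(1)}\otimes\cdots\otimes v^{(d)}$ with $v^{(e)}\in V^{(e)}$. The nuclear norm $\|T\|_\star$ of $T\in V$ is the smallest possible value of $\sum_{i=1}^m\|v_i\|$ over all decompositions $T=\sum_{i=1}^m v_i$ ($m$ arbitrary) into pure tensors $v_i$. For an $r$-tuple $\mathbf{S}=(S_1,\dots,S_r)$ of tensors in $V$ and $\alpha>0$, $[\mathbf{S}]_\alpha$ is the maximum of $\big(\sum_{i=1}^r|\langle S_i,u\rangle|^\alpha\big)^{1/\alpha}$ over all pure tensors $u\in V$ of unit length. *)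

theory Defs
  imports Complex_Main
begin

text \<open>
  A finite dimensional complex Hilbert space: a finite dimensional linear subspace \<open>H\<close> of some
  complex vector space, with an inner product \<open>ip\<close> on \<open>H\<close> (linear in the first argument).
  Completeness is automatic. The carrier \<open>H\<close> allows families of spaces of varying dimension.
\<close>

locale fd_hilbert = vector_space scale
  for scale :: "complex \<Rightarrow> 'a::ab_group_add \<Rightarrow> 'a" +
  fixes H :: "'a set" and ip :: "'a \<Rightarrow> 'a \<Rightarrow> complex"
  assumes subspace_H: "subspace H"
    and finite_dim: "\<exists>B. finite B \<and> span B = H"
    and ip_add: "\<lbrakk>x \<in> H; y \<in> H; z \<in> H\<rbrakk> \<Longrightarrow> ip (x + y) z = ip x z + ip y z"
    and ip_scale: "\<lbrakk>x \<in> H; y \<in> H\<rbrakk> \<Longrightarrow> ip (scale c x) y = c * ip x y"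
    and ip_cnj: "\<lbrakk>x \<in> H; y \<in> H\<rbrakk> \<Longrightarrow> ip y x = cnj (ip x y)"
    and ip_pos: "\<lbrakk>x \<in> H; x \<noteq> 0\<rbrakk> \<Longrightarrow> 0 < Re (ip x x)"

definition hnorm :: "('a \<Rightarrow> 'a \<Rightarrow> complex) \<Rightarrow> 'a \<Rightarrow> real" where
  "hnorm ip x = sqrt (Re (ip x x))"

definition pure_tensors :: "nat \<Rightarrow> (nat \<Rightarrow> 'a set) \<Rightarrow> ((nat \<Rightarrow> 'a) \<Rightarrow> 'v) \<Rightarrow> 'v set" where
  "pure_tensors d Vs tens = {tens v | v. \<forall>e\<in>{1..d}. v e \<in> Vs e}"

text \<open>
  \<open>V\<close> with inner product \<open>ip\<close> is the Hilbert space tensor product of \<open>Vs 1, \<dots>, Vs d\<close> with inner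
  products \<open>ips 1, \<dots>, ips d\<close>; \<open>tens v\<close> is \<open>v 1 \<otimes> \<dots> \<otimes> v d\<close>. The map \<open>tens\<close> is multilinear, its
  values span \<open>V\<close>, and the inner product is multiplicative on pure tensors. These conditions
  determine \<open>V\<close> up to a unique isometry compatible with \<open>tens\<close>: the linear map from the algebraic
  tensor product to \<open>V\<close> induced by \<open>tens\<close> is surjective and preserves inner products, hence is
  bijective. In particular \<open>tens v\<close> depends only on \<open>v 1, \<dots>, v d\<close>. The factors are subspaces of one
  ambient vector space (for instance their direct sum), each with its own inner product; nothing
  relates different factors.
\<close>

locale hilbert_tensor_product = V: fd_hilbert scaleV V ip
  for scaleV :: "complex \<Rightarrow> 'v::ab_group_add \<Rightarrow> 'v" and V :: "'v set"
    and ip :: "'v \<Rightarrow> 'v \<Rightarrow> complex" +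
  fixes d :: nat
    and scale :: "complex \<Rightarrow> 'a::ab_group_add \<Rightarrow> 'a"
    and Vs :: "nat \<Rightarrow> 'a set"
    and ips :: "nat \<Rightarrow> 'a \<Rightarrow> 'a \<Rightarrow> complex"
    and tens :: "(nat \<Rightarrow> 'a) \<Rightarrow> 'v"
  assumes d_pos: "d \<ge> 1"
    and factor: "e \<in> {1..d} \<Longrightarrow> fd_hilbert scale (Vs e) (ips e)"
    and tens_add: "\<lbrakk>\<forall>e\<in>{1..d}. v e \<in> Vs e; e \<in> {1..d}; x \<in> Vs e; y \<in> Vs e\<rbrakk>
      \<Longrightarrow> tens (v(e := x + y)) = tens (v(e := x)) + tens (v(e := y))"
    and tens_scale: "\<lbrakk>\<forall>e\<in>{1..d}. v e \<in> Vs e; e \<in> {1..d}; x \<in> Vs e\<rbrakk>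
      \<Longrightarrow> tens (v(e := scale c x)) = scaleV c (tens (v(e := x)))"
    and span_pure: "V.span (pure_tensors d Vs tens) = V"
    and ip_tens: "\<lbrakk>\<forall>e\<in>{1..d}. v e \<in> Vs e; \<forall>e\<in>{1..d}. w e \<in> Vs e\<rbrakk>
      \<Longrightarrow> ip (tens v) (tens w) = (\<Prod>e=1..d. ips e (v e) (w e))"

definition nuclear_norm ::
  "('v::ab_group_add \<Rightarrow> 'v \<Rightarrow> complex) \<Rightarrow> nat \<Rightarrow> (nat \<Rightarrow> 'a set) \<Rightarrow> ((nat \<Rightarrow> 'a) \<Rightarrow> 'v) \<Rightarrow> 'v \<Rightarrow> real"
  where
  "nuclear_norm ip d Vs tens T =
    (LEAST c. \<exists>m u. (\<forall>i\<in>{1..m::nat}. u i \<in> pure_tensors d Vs tens) \<and>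
       T = (\<Sum>i=1..m. u i) \<and> c = (\<Sum>i=1..m. hnorm ip (u i)))"

text \<open>
  \<open>[S]\<^sub>\<alpha>\<close> for the tuple \<open>S = (S 1, \<dots>, S r)\<close>. If \<open>V\<close> is the zero space there is no pure tensor of
  unit length and the value is unspecified.
\<close>

definition alpha_bracket ::
  "('v \<Rightarrow> 'v \<Rightarrow> complex) \<Rightarrow> nat \<Rightarrow> (nat \<Rightarrow> 'a set) \<Rightarrow> ((nat \<Rightarrow> 'a) \<Rightarrow> 'v) \<Rightarrow>
    nat \<Rightarrow> (nat \<Rightarrow> 'v) \<Rightarrow> real \<Rightarrow> real" where
  "alpha_bracket ip d Vs tens r S \<alpha> =
    (GREATEST c. \<exists>u\<in>pure_tensors d Vs tens. hnorm ip u = 1 \<and>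
       c = (\<Sum>i=1..r. cmod (ip (S i) u) powr \<alpha>) powr (1 / \<alpha>))"

end

theory Submission
  imports Defs "HOL-Analysis.Analysis"
begin

text \<open>
  If \<open>T = \<Sum>\<^sub>j c\<^sub>j w\<^sub>j\<close> with \<open>c\<^sub>j \<ge> 0\<close> and pure unit tensors \<open>w\<^sub>j\<close>, then convexity of \<open>x powr \<alpha>\<close> bounds
  the \<open>\<alpha>\<close>-norm of the tuple of all \<open>\<langle>T, S\<^sub>i\<rangle>\<close> by \<open>(\<Sum>\<^sub>j c\<^sub>j) [S]\<^sub>\<alpha>\<close>. The remaining issue is that the
  extrema defining the nuclear norm and \<open>[S]\<^sub>\<alpha>\<close> are attained (otherwise \<open>LEAST\<close> and \<open>GREATEST\<close> are
  unspecified). Pure unit tensors are images of tuples of unit vectors, so they are sequentially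
  compact, which settles \<open>[S]\<^sub>\<alpha>\<close>. For the nuclear norm, Caratheodory's argument over the reals bounds
  the number of summands by the real dimension of \<open>V\<close>, after which compactness applies again.
\<close>

section \<open>Extraction of subsequences and sequential compactness\<close>

lemma finite_common_subseq:
  fixes P :: "'i \<Rightarrow> (nat \<Rightarrow> nat) \<Rightarrow> bool"
  assumes "finite I"
    and "\<And>i (s :: nat \<Rightarrow> nat). i \<in> I \<Longrightarrow> strict_mono s \<Longrightarrow> \<exists>t. strict_mono t \<and> P i (s \<circ> t)"
    and "\<And>i s t. i \<in> I \<Longrightarrow> P i s \<Longrightarrow> strict_mono t \<Longrightarrow> P i (s \<circ> t)"
  shows "\<exists>s. strict_mono s \<and> (\<forall>i\<in>I. P i s)"
  using assms
proof (induction I rule: finite_induct)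
  case empty
  then show ?case by (auto intro: exI[of _ id] strict_mono_id)
next
  case (insert i I)
  have "\<exists>s. strict_mono s \<and> (\<forall>i\<in>I. P i s)"
    by (rule insert.IH) (use insert.prems in \<open>blast+\<close>)
  then obtain s where s: "strict_mono s" "\<forall>i\<in>I. P i s"
    by blast
  obtain t where t: "strict_mono t" "P i (s \<circ> t)"
    using insert.prems(1)[of i s] s by blast
  have "strict_mono (s \<circ> t)"
    using s t strict_mono_o by blast
  moreover have "\<forall>j\<in>insert i I. P j (s \<circ> t)"
    using s t insert.prems(2) by blast
  ultimately show ?case by blast
qed

text \<open>The domain of \<open>F\<close> carries no topology: compactness of a set of reals only
  involves the values of \<open>F\<close>. This is what makes extrema over \<open>U\<close> attained
  later.\<close>

lemma compact_image_seq:
  fixes F :: "'b \<Rightarrow> real"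
  assumes "\<And>u. (\<And>n. u n \<in> U) \<Longrightarrow>
    \<exists>s l. strict_mono (s :: nat \<Rightarrow> nat) \<and> l \<in> U \<and> (\<lambda>n. F (u (s n))) \<longlonglongrightarrow> F l"
  shows "compact (F ` U)"
  unfolding compact_eq_seq_compact_metric seq_compact_def
proof (intro allI impI)
  fix f :: "nat \<Rightarrow> real"
  assume "\<forall>n. f n \<in> F ` U"
  then have "\<forall>n. \<exists>x. x \<in> U \<and> f n = F x"
    by auto
  then obtain u where "\<forall>n. u n \<in> U \<and> f n = F (u n)"
    by (rule choice[THEN exE])
  then have u: "\<And>n. u n \<in> U" "\<And>n. f n = F (u n)"
    by auto
  obtain s l where s: "strict_mono (s :: nat \<Rightarrow> nat)" "l \<in> U" "(\<lambda>n. F (u (s n))) \<longlonglongrightarrow> F l"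
    using assms u(1) by blast
  then show "\<exists>l\<in>F ` U. \<exists>r. strict_mono r \<and> (f \<circ> r) \<longlonglongrightarrow> l"
    by (intro bexI[of _ "F l"] exI[of _ s]) (auto simp: u(2) o_def)
qed

lemma bounded_complex_subseq:
  fixes f :: "nat \<Rightarrow> complex"
  assumes "\<And>n. cmod (f n) \<le> C"
  shows "\<exists>l s. strict_mono (s :: nat \<Rightarrow> nat) \<and> (\<lambda>n. f (s n)) \<longlonglongrightarrow> l"
proof -
  have "bounded (range f)"
    using assms by (auto simp: bounded_iff)
  then show ?thesis
    using bounded_imp_convergent_subsequence[of f] by (auto simp: o_def)
qed

section \<open>Finite dimensional Hilbert spaces\<close>

context fd_hilbert
begin

lemmas H_closed = subspace_0[OF subspace_H] subspace_add[OF subspace_H]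
  subspace_scale[OF subspace_H] subspace_diff[OF subspace_H] subspace_neg[OF subspace_H]

lemma H_sum: "(\<And>i. i \<in> A \<Longrightarrow> f i \<in> H) \<Longrightarrow> (\<Sum>i\<in>A. f i) \<in> H"
  by (rule subspace_sum[OF subspace_H])

lemma ip_zero_left: "y \<in> H \<Longrightarrow> ip 0 y = 0"
  using ip_scale[of 0 y 0] H_closed(1) by simp

lemma ip_add_right: "\<lbrakk>x \<in> H; y \<in> H; z \<in> H\<rbrakk> \<Longrightarrow> ip z (x + y) = ip z x + ip z y"
  by (metis H_closed(2) complex_cnj_add ip_add ip_cnj)

lemma ip_scale_right: "\<lbrakk>x \<in> H; y \<in> H\<rbrakk> \<Longrightarrow> ip y (scale c x) = cnj c * ip y x"
  by (metis H_closed(3) complex_cnj_mult ip_cnj ip_scale)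

lemma ip_diff_left: "\<lbrakk>x \<in> H; y \<in> H; z \<in> H\<rbrakk> \<Longrightarrow> ip (x - y) z = ip x z - ip y z"
  using ip_add[of "x - y" y z] H_closed by simp

lemma ip_sum_left:
  "\<lbrakk>\<And>i. i \<in> A \<Longrightarrow> f i \<in> H; z \<in> H\<rbrakk> \<Longrightarrow> ip (\<Sum>i\<in>A. f i) z = (\<Sum>i\<in>A. ip (f i) z)"
  by (induction A rule: infinite_finite_induct) (auto simp: ip_zero_left ip_add H_sum)

lemma ip_lincomb_left:
  "\<lbrakk>\<And>i. i \<in> A \<Longrightarrow> f i \<in> H; z \<in> H\<rbrakk>
    \<Longrightarrow> ip (\<Sum>i\<in>A. scale (c i) (f i)) z = (\<Sum>i\<in>A. c i * ip (f i) z)"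
  by (simp add: ip_sum_left H_closed ip_scale)

lemma hnorm_nonneg: "x \<in> H \<Longrightarrow> 0 \<le> hnorm ip x"
  using ip_pos[of x] ip_zero_left[of 0] H_closed(1)
  by (cases "x = 0") (auto simp: hnorm_def)

lemma hnorm_pos: "x \<in> H \<Longrightarrow> x \<noteq> 0 \<Longrightarrow> 0 < hnorm ip x"
  using ip_pos[of x] by (auto simp: hnorm_def)

lemma hnorm_zero: "hnorm ip 0 = 0"
  using ip_zero_left[of 0] H_closed(1) by (auto simp: hnorm_def)

lemma ip_self:
  assumes "x \<in> H"
  shows "ip x x = of_real ((hnorm ip x)\<^sup>2)"
proof -
  have "Im (ip x x) = 0"
    using ip_cnj[of x x] assms by (simp add: complex_eq_iff)
  moreover have "0 \<le> Re (ip x x)"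
    using assms ip_pos[of x] ip_zero_left[of 0] by (cases "x = 0") auto
  ultimately show ?thesis
    by (simp add: hnorm_def complex_eq_iff)
qed

lemma hnorm_scale:
  assumes "x \<in> H"
  shows "hnorm ip (scale c x) = cmod c * hnorm ip x"
proof -
  have "ip (scale c x) (scale c x) = c * cnj c * ip x x"
    using assms by (simp add: ip_scale ip_scale_right H_closed)
  also have "c * cnj c = of_real ((cmod c)\<^sup>2)"
    by (simp add: complex_norm_square del: of_real_power)
  finally have "complex_of_real ((hnorm ip (scale c x))\<^sup>2) = of_real ((cmod c * hnorm ip x)\<^sup>2)"
    using assms by (simp only: ip_self H_closed of_real_mult power_mult_distrib)
  then have "(hnorm ip (scale c x))\<^sup>2 = (cmod c * hnorm ip x)\<^sup>2"
    by (simp only: of_real_eq_iff)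
  then show ?thesis
    using assms by (simp add: H_closed hnorm_nonneg)
qed

text \<open>The right argument enters conjugate-linearly, so convergence against the vectors of
  \<open>X\<close> survives finite linear combinations. For constant sequences this yields
  \<open>ip_eq_span\<close>.\<close>

lemma tendsto_ip_span:
  assumes "X \<subseteq> H" and "\<And>n. x n \<in> H" and "l \<in> H"
    and "\<And>b. b \<in> X \<Longrightarrow> (\<lambda>n. ip (x n) b) \<longlonglongrightarrow> ip l b"
    and "z \<in> span X"
  shows "(\<lambda>n. ip (x n) z) \<longlonglongrightarrow> ip l z"
proof -
  have "z \<in> H \<and> (\<lambda>n. ip (x n) z) \<longlonglongrightarrow> ip l z"
    using assms(5)
  proof (induction rule: span_induct_alt)
    case base
    then show ?case
      using ip_scale_right[of 0 _ 0] assms(2,3) H_closed(1) by simp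
  next
    case (step c b y)
    then have "b \<in> H"
      using assms(1) by auto
    with step assms(2,3) show ?case
      by (auto simp: ip_add_right ip_scale_right H_closed intro!: tendsto_intros assms(4))
  qed
  then show ?thesis ..
qed

lemma ip_eq_span:
  assumes "X \<subseteq> H" and "x \<in> H" and "y \<in> H" and "\<And>b. b \<in> X \<Longrightarrow> ip x b = ip y b" and "z \<in> span X"
  shows "ip x z = ip y z"
  using tendsto_ip_span[of X "\<lambda>_. x" y z] assms by (simp add: tendsto_const_iff)

lemma ip_eqI:
  assumes "x \<in> H" and "y \<in> H" and "\<And>z. z \<in> H \<Longrightarrow> ip x z = ip y z"
  shows "x = y"
proof -
  have "ip (x - y) (x - y) = 0"
    using assms by (simp add: ip_diff_left H_closed)
  then show ?thesis
    using ip_pos[of "x - y"] assms H_closed by fastforce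
qed

text \<open>Induction on \<open>C\<close>: subtract from the new vector its projection onto the span
  so far and normalize the remainder, unless it vanishes.\<close>

lemma gram_schmidt:
  assumes "finite C" and "C \<subseteq> H"
  shows "\<exists>B. finite B \<and> B \<subseteq> H \<and> span B = span C \<and>
    (\<forall>b\<in>B. \<forall>c\<in>B. ip b c = (if b = c then 1 else 0))"
  using assms
proof (induction C rule: finite_induct)
  case empty
  then show ?case by (auto intro!: exI[of _ "{}"])
next
  case (insert b C)
  then obtain B where B: "finite B" "B \<subseteq> H" "span B = span C"
    and on: "\<And>b c. b \<in> B \<Longrightarrow> c \<in> B \<Longrightarrow> ip b c = (if b = c then 1 else 0)"
    by auto
  have b: "b \<in> H"
    using insert by auto
  \<comment> \<open>\<open>p\<close> is the orthogonal projection of \<open>b\<close> onto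
    \<open>span B\<close>, so the remainder \<open>q\<close> is orthogonal to
    \<open>B\<close>.\<close>
  define p where "p = (\<Sum>c\<in>B. scale (ip b c) c)"
  define q where "q = b - p"
  have p: "p \<in> span B"
    unfolding p_def by (intro span_sum span_scale span_base)
  have pH: "p \<in> H"
    unfolding p_def using B by (intro H_sum H_closed) auto
  have qH: "q \<in> H"
    unfolding q_def using b pH by (rule H_closed)
  have orth: "ip q c = 0" if "c \<in> B" for c
  proof -
    have "ip p c = (\<Sum>x\<in>B. ip b x * ip x c)"
      unfolding p_def using B that by (intro ip_lincomb_left) auto
    also have "\<dots> = (\<Sum>x\<in>B. if x = c then ip b c else 0)"
      using that by (intro sum.cong) (auto simp: on)
    also have "\<dots> = ip b c"
      using that B by simp
    finally show ?thesis
      unfolding q_def using b pH that B by (subst ip_diff_left) auto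
  qed
  have spC: "span (insert b C) = span (insert b B)"
    using B(3) by (simp add: span_insert)
  show ?case
  proof (cases "q = 0")
    case True
    then have "b \<in> span B"
      using p by (simp add: q_def)
    then have "span (insert b B) = span B"
      by (rule span_redundant)
    with spC B on show ?thesis
      by (intro exI[of _ B]) auto
  next
    case False
    define k where "k = hnorm ip q"
    have k: "k > 0"
      unfolding k_def using qH False by (rule hnorm_pos)
    define e where "e = scale (1 / of_real k) q"
    have eH: "e \<in> H"
      unfolding e_def using qH by (rule H_closed)
    have eo: "ip e c = 0" if "c \<in> B" for c
      using that orth qH B by (auto simp: e_def ip_scale)
    have oe: "ip c e = 0" if "c \<in> B" for c
      using that eo ip_cnj[of e c] eH B by auto
    have ee: "ip e e = 1"
      using qH k
      by (simp add: e_def ip_self H_closed hnorm_scale norm_divide flip: k_def)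
    have "b = p + scale (of_real k) e"
      using k by (simp add: e_def q_def)
    then have "b \<in> span (insert e B)"
      by (metis insertI1 p span_add span_base span_mono span_scale subset_insertI subsetD)
    moreover have "q \<in> span (insert b B)"
      unfolding q_def
      by (metis insertI1 p span_diff span_base span_mono subset_insertI subsetD)
    then have "e \<in> span (insert b B)"
      unfolding e_def by (rule span_scale)
    ultimately have "span (insert e B) = span (insert b B)"
      unfolding span_eq by (auto intro: span_base)
    moreover have "\<forall>x\<in>insert e B. \<forall>y\<in>insert e B. ip x y = (if x = y then 1 else 0)"
    proof -
      \<comment> \<open>Otherwise \<open>eo\<close> would give \<open>ip e e = 0\<close>. This
        separates the new basis vector from the old ones in the test \<open>x = y\<close>.\<close>
      have "e \<notin> B"
        using eo[of e] ee by auto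
      then show ?thesis
        using on eo oe ee by (metis insert_iff)
    qed
    ultimately show ?thesis
      using spC B eH by (intro exI[of _ "insert e B"]) simp
  qed
qed

lemma orthonormal_basis:
  obtains B where "finite B" and "B \<subseteq> H" and "span B = H"
    and "\<And>b c. b \<in> B \<Longrightarrow> c \<in> B \<Longrightarrow> ip b c = (if b = c then 1 else 0)"
proof -
  obtain C where C: "finite C" "span C = H"
    using finite_dim by blast
  then have "C \<subseteq> H"
    using span_superset by blast
  from gram_schmidt[OF C(1) this] C(2) that show thesis
    by metis
qed

text \<open>Convergence is expressed through inner products and norms, so no topology on \<open>'a\<close> is needed.\<close>

lemma unit_sphere_seq_compact:
  assumes "\<And>n. x n \<in> H" and "\<And>n. hnorm ip (x n) = 1"
  shows "\<exists>s l. strict_mono (s :: nat \<Rightarrow> nat) \<and> l \<in> H \<and> hnorm ip l = 1 \<and>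
    (\<forall>y\<in>H. (\<lambda>n. ip (x (s n)) y) \<longlonglongrightarrow> ip l y)"
proof -
  obtain B where B: "finite B" "B \<subseteq> H" "span B = H"
    and on: "\<And>b c. b \<in> B \<Longrightarrow> c \<in> B \<Longrightarrow> ip b c = (if b = c then 1 else 0)"
    using orthonormal_basis by blast
  have coord: "ip (\<Sum>b\<in>B. scale (a b) b) c = a c" if "c \<in> B" for a c
  proof -
    have "ip (\<Sum>b\<in>B. scale (a b) b) c = (\<Sum>b\<in>B. a b * ip b c)"
      using B that by (intro ip_lincomb_left) auto
    also have "\<dots> = (\<Sum>b\<in>B. if b = c then a c else 0)"
      using that by (intro sum.cong) (auto simp: on)
    finally show ?thesis
      using that B by simp
  qed
  have combH: "(\<Sum>b\<in>B. scale (a b) b) \<in> H" for a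
    using B by (intro H_sum H_closed) auto
  \<comment> \<open>Both sides have the same coordinates against \<open>B\<close>, and
    \<open>B\<close> spans \<open>H\<close>.\<close>
  have expand: "y = (\<Sum>b\<in>B. scale (ip y b) b)" if "y \<in> H" for y
    using ip_eq_span[OF B(2) that combH] coord that combH B(3) by (intro ip_eqI) auto
  have parseval: "of_real ((hnorm ip y)\<^sup>2) = (\<Sum>b\<in>B. ip y b * cnj (ip y b))" if "y \<in> H" for y
  proof -
    have "of_real ((hnorm ip y)\<^sup>2) = ip y y"
      using that by (simp add: ip_self)
    also have "\<dots> = ip (\<Sum>b\<in>B. scale (ip y b) b) y"
      using expand[OF that] by simp
    also have "\<dots> = (\<Sum>b\<in>B. ip y b * ip b y)"
      using B that by (intro ip_lincomb_left) auto
    also have "\<dots> = (\<Sum>b\<in>B. ip y b * cnj (ip y b))"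
      using B that by (intro sum.cong refl) (metis ip_cnj subsetD)
    finally show ?thesis .
  qed
  \<comment> \<open>By Parseval the squared moduli of the coordinates of a unit vector sum to 1.
    Bounded coordinates then allow Bolzano-Weierstrass for each \<open>b\<close>.\<close>
  have bound: "cmod (ip (x n) b) \<le> 1" if "b \<in> B" for n b
  proof -
    have "complex_of_real 1 = of_real (\<Sum>b\<in>B. (cmod (ip (x n) b))\<^sup>2)"
      using parseval[of "x n"] assms by (simp add: complex_norm_square del: of_real_power)
    then have "1 = (\<Sum>b\<in>B. (cmod (ip (x n) b))\<^sup>2)"
      by (simp only: of_real_eq_iff)
    moreover have "(cmod (ip (x n) b))\<^sup>2 \<le> (\<Sum>b\<in>B. (cmod (ip (x n) b))\<^sup>2)"
      using B that by (intro member_le_sum) auto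
    ultimately have "(cmod (ip (x n) b))\<^sup>2 \<le> 1\<^sup>2"
      by simp
    then show ?thesis
      by (rule power2_le_imp_le) simp
  qed
  have "\<exists>s. strict_mono s \<and> (\<forall>b\<in>B. convergent (\<lambda>n. ip (x (s n)) b))"
  proof (rule finite_common_subseq[OF B(1)])
    fix b and s :: "nat \<Rightarrow> nat"
    assume "b \<in> B"
    then show "\<exists>t. strict_mono t \<and> convergent (\<lambda>n. ip (x ((s \<circ> t) n)) b)"
      using bounded_complex_subseq[of "\<lambda>n. ip (x (s n)) b" 1] bound
      by (auto simp: convergent_def)
  next
    fix b and s t :: "nat \<Rightarrow> nat"
    assume "convergent (\<lambda>n. ip (x (s n)) b)" "strict_mono t"
    then show "convergent (\<lambda>n. ip (x ((s \<circ> t) n)) b)"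
      using convergent_subseq_convergent[of "\<lambda>n. ip (x (s n)) b" t] by (simp add: o_def)
  qed
  then obtain s a where s: "strict_mono s"
    and a: "\<And>b. b \<in> B \<Longrightarrow> (\<lambda>n. ip (x (s n)) b) \<longlonglongrightarrow> a b"
    unfolding convergent_def by metis
  \<comment> \<open>The limit vector is assembled from the limits of the coordinates. Parseval is a
    finite sum, so the norm 1 passes to the limit.\<close>
  define l where "l = (\<Sum>b\<in>B. scale (a b) b)"
  have lH: "l \<in> H"
    unfolding l_def by (rule combH)
  have lb: "ip l b = a b" if "b \<in> B" for b
    unfolding l_def using that by (rule coord)
  have "(\<lambda>n. \<Sum>b\<in>B. ip (x (s n)) b * cnj (ip (x (s n)) b)) \<longlonglongrightarrow> (\<Sum>b\<in>B. a b * cnj (a b))"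
    by (intro tendsto_intros a)
  moreover have "(\<Sum>b\<in>B. ip (x (s n)) b * cnj (ip (x (s n)) b)) = 1" for n
    using parseval[of "x (s n)"] assms by simp
  moreover have "(\<Sum>b\<in>B. a b * cnj (a b)) = of_real ((hnorm ip l)\<^sup>2)"
    using lb by (subst parseval[OF lH]) (auto intro: sum.cong)
  ultimately have "of_real ((hnorm ip l)\<^sup>2) = (1::complex)"
    by (simp add: tendsto_const_iff)
  then have "(hnorm ip l)\<^sup>2 = 1"
    by (metis of_real_eq_1_iff)
  then have "hnorm ip l = 1"
    using hnorm_nonneg[OF lH] power2_eq_1_iff[of "hnorm ip l"] by auto
  moreover have "(\<lambda>n. ip (x (s n)) y) \<longlonglongrightarrow> ip l y" if "y \<in> H" for y
    using tendsto_ip_span[OF B(2), of "\<lambda>n. x (s n)" l y] assms(1) lH a lb B(3) that by simp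
  ultimately show ?thesis
    using s lH by blast
qed

end

section \<open>Caratheodory reduction\<close>

text \<open>
  While \<open>X\<close> is dependent, move along a dependence of nonnegative total weight until the first
  coefficient vanishes.
\<close>

lemma conic_caratheodory:
  fixes scale :: "real \<Rightarrow> 'b::ab_group_add \<Rightarrow> 'b"
  assumes "vector_space scale" and "finite B"
    and "finite X" and "X \<subseteq> module.span scale B" and "\<And>x. x \<in> X \<Longrightarrow> 0 \<le> f x"
  shows "\<exists>Y g. Y \<subseteq> X \<and> card Y \<le> card B \<and> (\<forall>x\<in>Y. 0 \<le> g x) \<and>
    (\<Sum>x\<in>Y. scale (g x) x) = (\<Sum>x\<in>X. scale (f x) x) \<and> sum g Y \<le> sum f X"
  using assms(3-5)
proof (induction "card X" arbitrary: X f rule: less_induct)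
  case less
  interpret vector_space scale by (rule assms(1))
  show ?case
  proof (cases "card X \<le> card B")
    case True
    then show ?thesis using less.prems by (intro exI[of _ X] exI[of _ f]) auto
  next
    case False
    \<comment> \<open>An independent set inside the span of \<open>B\<close> has at most
      \<open>card B\<close> elements.\<close>
    have "dependent X"
      using independent_span_bound[OF assms(2), of X] less.prems False by auto
    then obtain h where h: "\<exists>x\<in>X. h x \<noteq> 0" "(\<Sum>x\<in>X. scale (h x) x) = 0"
      using dependent_finite[OF less.prems(1)] by auto
    \<comment> \<open>The sign is chosen so that the total weight of \<open>t\<close> is
      nonnegative; subtracting a nonnegative multiple of \<open>t\<close> then never increases the
      total of \<open>f\<close>.\<close>
    define t where "t = (if sum h X \<ge> 0 then h else (\<lambda>x. - h x))"
    have t0: "(\<Sum>x\<in>X. scale (t x) x) = 0" "sum t X \<ge> 0" "\<exists>x\<in>X. t x \<noteq> 0"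
      using h by (auto simp: t_def sum_negf)
    have "\<exists>x\<in>X. t x > 0"
    proof (rule ccontr)
      assume neg: "\<not> ?thesis"
      then have "sum t X = 0"
        using t0(2) sum_nonpos[of X t] by force
      then have "sum (\<lambda>x. - t x) X = 0" by (simp add: sum_negf)
      then show False
        using neg t0(3) less.prems(1) sum_nonneg_eq_0_iff[of X "\<lambda>x. - t x"] by force
    qed
    then have "finite {x\<in>X. t x > 0}" "{x\<in>X. t x > 0} \<noteq> {}"
      using less.prems(1) by auto
    then obtain y where y: "y \<in> X" "t y > 0"
      and min: "\<And>x. x \<in> X \<Longrightarrow> t x > 0 \<Longrightarrow> f y / t y \<le> f x / t x"
      using arg_min_if_finite[of "{x\<in>X. t x > 0}" "\<lambda>x. f x / t x"] by force
    define k where "k = f y / t y"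
    define g where "g = (\<lambda>x. f x - k * t x)"
    have k: "k \<ge> 0" using y less.prems(3) by (simp add: k_def)
    have gpos: "g x \<ge> 0" if "x \<in> X" for x
    proof (cases "t x > 0")
      case True
      then show ?thesis
        using min[OF that] by (simp add: g_def k_def field_simps)
    next
      case False
      then have "k * t x \<le> 0" using k by (simp add: mult_nonneg_nonpos)
      then show ?thesis using less.prems(3)[OF that] by (simp add: g_def)
    qed
    have gy: "g y = 0" using y by (simp add: g_def k_def)
    have "(\<Sum>x\<in>X. scale (g x) x) = (\<Sum>x\<in>X. scale (f x) x) - scale k (\<Sum>x\<in>X. scale (t x) x)"
      by (simp add: g_def scale_left_diff_distrib sum_subtractf scale_sum_right)
    then have comb: "(\<Sum>x\<in>X - {y}. scale (g x) x) = (\<Sum>x\<in>X. scale (f x) x)"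
      using t0 y less.prems(1) gy by (simp add: sum.remove)
    have "sum g X = sum f X - k * sum t X"
      by (simp add: g_def sum_subtractf sum_distrib_left)
    also have "\<dots> \<le> sum f X" using k t0 by simp
    finally have le: "sum g (X - {y}) \<le> sum f X"
      using y less.prems(1) gy by (simp add: sum.remove)
    have "card (X - {y}) < card X"
      using less.prems(1) y(1) by (rule card_Diff1_less)
    from less.hyps[OF this, of g] obtain Y g' where
      "Y \<subseteq> X - {y}" "card Y \<le> card B" "\<forall>x\<in>Y. 0 \<le> g' x"
      "(\<Sum>x\<in>Y. scale (g' x) x) = (\<Sum>x\<in>X - {y}. scale (g x) x)" "sum g' Y \<le> sum g (X - {y})"
      using less.prems gpos by auto
    then show ?thesis
      using comb le by (intro exI[of _ Y] exI[of _ g']) auto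
  qed
qed

text \<open>Splitting a complex coefficient into real and imaginary part replaces it by real
  coefficients on \<open>b\<close> and \<i> times \<open>b\<close>. Real scalars are required
  because \<open>conic_caratheodory\<close> works with nonnegative weights.\<close>

lemma (in fd_hilbert) real_span:
  assumes "finite B" and "span B = H"
  defines "sc \<equiv> \<lambda>t::real. scale (of_real t)"
  shows "vector_space sc" and "H \<subseteq> module.span sc (B \<union> scale \<i> ` B)"
proof -
  show vs: "vector_space sc"
    unfolding sc_def by unfold_locales (simp_all add: scale_right_distrib scale_left_distrib)
  interpret R: vector_space sc by (rule vs)
  show "H \<subseteq> R.span (B \<union> scale \<i> ` B)"
  proof
    fix x assume "x \<in> H"
    then have "x \<in> span B" using assms by simp
    then show "x \<in> R.span (B \<union> scale \<i> ` B)"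
    proof (induction rule: span_induct_alt)
      case base
      then show ?case by (rule R.span_zero)
    next
      case (step c b y)
      have "scale c b = sc (Re c) b + sc (Im c) (scale \<i> b)"
        by (subst complex_eq[of c]) (simp add: sc_def scale_left_distrib mult.commute)
      moreover have "sc (Re c) b + sc (Im c) (scale \<i> b) \<in> R.span (B \<union> scale \<i> ` B)"
        using step by (intro R.span_add R.span_scale R.span_base) auto
      ultimately show ?case using step by (simp add: R.span_add)
    qed
  qed
qed

section \<open>Tensor products\<close>

context hilbert_tensor_product
begin

abbreviation "pure \<equiv> pure_tensors d Vs tens"

section \<open>Pure tensors of unit length and their compactness\<close>

definition "unit_pure = {u \<in> pure. hnorm ip u = 1}"

lemma pure_in: "u \<in> pure \<Longrightarrow> u \<in> V"
  using V.span_base[of u pure] span_pure by simp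

lemma unit_pureD: "u \<in> unit_pure \<Longrightarrow> u \<in> pure" "u \<in> unit_pure \<Longrightarrow> u \<in> V"
    "u \<in> unit_pure \<Longrightarrow> hnorm ip u = 1"
  using pure_in by (auto simp: unit_pure_def)

lemma tens_in: "\<forall>e\<in>{1..d}. v e \<in> Vs e \<Longrightarrow> tens v \<in> V"
  using pure_in by (auto simp: pure_tensors_def)

text \<open>The scalar is absorbed by the first factor, which exists by
  \<open>d_pos\<close>.\<close>

lemma pure_scale:
  assumes "u \<in> pure"
  shows "scaleV c u \<in> pure"
proof -
  obtain v where v: "\<forall>e\<in>{1..d}. v e \<in> Vs e" "u = tens v"
    using assms by (auto simp: pure_tensors_def)
  have 1: "1 \<in> {1..d}"
    using d_pos by simp
  interpret F: fd_hilbert scale "Vs 1" "ips 1"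
    using 1 by (rule factor)
  have "tens (v(1 := scale c (v 1))) = scaleV c u"
    using tens_scale[OF v(1) 1, of "v 1" c] v 1 by simp
  moreover have "\<forall>e\<in>{1..d}. (v(1 := scale c (v 1))) e \<in> Vs e"
    using v 1 F.H_closed(3) by auto
  ultimately show ?thesis
    unfolding pure_tensors_def by (intro CollectI exI[of _ "v(1 := scale c (v 1))"]) simp
qed

text \<open>Multilinearity used one slot at a time. With \<open>F = {1..d}\<close> it rescales all
  factors of a pure tensor at once.\<close>

lemma tens_scale_prod:
  assumes "finite F" and "F \<subseteq> {1..d}" and v: "\<forall>e\<in>{1..d}. v e \<in> Vs e"
  shows "tens (\<lambda>e. if e \<in> F then scale (c e) (v e) else v e) = scaleV (\<Prod>e\<in>F. c e) (tens v)"
  using assms(1,2)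
proof (induction F rule: finite_induct)
  case empty
  then show ?case by simp
next
  case (insert e F)
  define w where "w = (\<lambda>e. if e \<in> F then scale (c e) (v e) else v e)"
  have w: "\<forall>e\<in>{1..d}. w e \<in> Vs e"
    using v fd_hilbert.H_closed(3)[OF factor] by (auto simp: w_def)
  have "(\<lambda>e'. if e' \<in> insert e F then scale (c e') (v e') else v e') = w(e := scale (c e) (v e))"
    by (auto simp: w_def)
  moreover have "tens (w(e := scale (c e) (v e))) = scaleV (c e) (tens (w(e := v e)))"
    using insert.prems v by (intro tens_scale w) auto
  moreover have "w(e := v e) = w"
    using insert.hyps by (auto simp: w_def)
  moreover have "tens w = scaleV (\<Prod>e\<in>F. c e) (tens v)"
    unfolding w_def using insert by simp
  ultimately show ?case
    using insert.hyps by simp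
qed

lemma hnorm_tens:
  assumes v: "\<forall>e\<in>{1..d}. v e \<in> Vs e"
  shows "hnorm ip (tens v) = (\<Prod>e=1..d. hnorm (ips e) (v e))"
proof -
  have "complex_of_real ((hnorm ip (tens v))\<^sup>2) = (\<Prod>e=1..d. ips e (v e) (v e))"
    using V.ip_self[OF tens_in[OF v]] ip_tens[OF v v] by simp
  also have "\<dots> = (\<Prod>e=1..d. of_real ((hnorm (ips e) (v e))\<^sup>2))"
    using v fd_hilbert.ip_self[OF factor] by (intro prod.cong) auto
  also have "\<dots> = of_real ((\<Prod>e=1..d. hnorm (ips e) (v e))\<^sup>2)"
    by (simp add: prod_power_distrib)
  finally have "(hnorm ip (tens v))\<^sup>2 = (\<Prod>e=1..d. hnorm (ips e) (v e))\<^sup>2"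
    by (simp only: of_real_eq_iff)
  moreover have "0 \<le> (\<Prod>e=1..d. hnorm (ips e) (v e))"
    using v fd_hilbert.hnorm_nonneg[OF factor] by (intro prod_nonneg) auto
  ultimately show ?thesis
    using V.hnorm_nonneg[OF tens_in[OF v]] by simp
qed

text \<open>The factors of a unit pure tensor may have any norms with product 1. Dividing each
  factor by its norm therefore leaves the tensor unchanged.\<close>

lemma unit_pureE:
  assumes "u \<in> unit_pure"
  obtains v where "\<And>e. e \<in> {1..d} \<Longrightarrow> v e \<in> Vs e"
    and "\<And>e. e \<in> {1..d} \<Longrightarrow> hnorm (ips e) (v e) = 1" and "u = tens v"
proof -
  obtain v where v: "\<forall>e\<in>{1..d}. v e \<in> Vs e" and u: "u = tens v"
    using assms by (auto simp: unit_pure_def pure_tensors_def)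
  define h where "h = (\<lambda>e. hnorm (ips e) (v e))"
  have h1: "(\<Prod>e=1..d. h e) = 1"
    unfolding h_def using assms u hnorm_tens[OF v] unit_pureD(3) by simp
  then have h0: "h e \<noteq> 0" if "e \<in> {1..d}" for e
    using that by (metis finite_atLeastAtMost prod_zero zero_neq_one)
  define w where "w = (\<lambda>e. if e \<in> {1..d} then scale (1 / of_real (h e)) (v e) else v e)"
  have "tens w = scaleV (\<Prod>e=1..d. 1 / of_real (h e)) (tens v)"
    unfolding w_def by (rule tens_scale_prod) (use v in auto)
  also have "(\<Prod>e=1..d. 1 / complex_of_real (h e)) = of_real (1 / (\<Prod>e=1..d. h e))"
    by (simp add: prod_dividef)
  finally have "u = tens w"
    unfolding h1 u by simp
  moreover have "w e \<in> Vs e" "hnorm (ips e) (w e) = 1" if e: "e \<in> {1..d}" for e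
  proof -
    interpret F: fd_hilbert scale "Vs e" "ips e"
      using e by (rule factor)
    have ve: "v e \<in> Vs e"
      using v e by auto
    then show "w e \<in> Vs e"
      using e F.H_closed(3) by (simp add: w_def)
    show "hnorm (ips e) (w e) = 1"
      using e ve h0[OF e] by (simp add: w_def h_def F.hnorm_scale norm_divide F.hnorm_nonneg)
  qed
  ultimately show thesis
    using that by blast
qed

text \<open>Unit factors can be chosen, and each factor has a convergent subsequence on its unit
  sphere. Against a pure tensor the inner product is a finite product of convergent factors; since
  pure tensors span \<open>V\<close>, convergence extends to all of \<open>V\<close>.\<close>

lemma unit_pure_seq_compact:
  assumes "\<And>n. u n \<in> unit_pure"
  shows "\<exists>s l. strict_mono (s :: nat \<Rightarrow> nat) \<and> l \<in> unit_pure \<and>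
    (\<forall>y\<in>V. (\<lambda>n. ip (u (s n)) y) \<longlonglongrightarrow> ip l y)"
proof -
  have "\<forall>n. \<exists>v. (\<forall>e\<in>{1..d}. v e \<in> Vs e \<and> hnorm (ips e) (v e) = 1) \<and> u n = tens v"
  proof
    fix n
    show "\<exists>v. (\<forall>e\<in>{1..d}. v e \<in> Vs e \<and> hnorm (ips e) (v e) = 1) \<and> u n = tens v"
      by (rule unit_pureE[OF assms[of n]]) blast
  qed
  from choice[OF this] obtain v where
    v: "\<And>n e. e \<in> {1..d} \<Longrightarrow> v n e \<in> Vs e" "\<And>n e. e \<in> {1..d} \<Longrightarrow> hnorm (ips e) (v n e) = 1"
    and u: "\<And>n. u n = tens (v n)"
    by blast
  define Q where "Q = (\<lambda>e s l. l \<in> Vs e \<and> hnorm (ips e) l = 1 \<and>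
    (\<forall>y\<in>Vs e. (\<lambda>n::nat. ips e (v (s n) e) y) \<longlonglongrightarrow> ips e l y))"
  have "\<exists>s. strict_mono s \<and> (\<forall>e\<in>{1..d}. \<exists>l. Q e s l)"
  proof (rule finite_common_subseq)
    fix e and s :: "nat \<Rightarrow> nat"
    assume e: "e \<in> {1..d}"
    show "\<exists>t. strict_mono t \<and> (\<exists>l. Q e (s \<circ> t) l)"
      using fd_hilbert.unit_sphere_seq_compact[OF factor[OF e], of "\<lambda>n. v (s n) e"] v[OF e]
      unfolding Q_def comp_def by blast
  next
    fix e and s t :: "nat \<Rightarrow> nat"
    assume "\<exists>l. Q e s l" and t: "strict_mono t"
    then obtain l where l: "Q e s l"
      by blast
    have "Q e (s \<circ> t) l"
      using l LIMSEQ_subseq_LIMSEQ[OF _ t] unfolding Q_def comp_def by fast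
    then show "\<exists>l. Q e (s \<circ> t) l"
      by blast
  qed simp
  then obtain s where s: "strict_mono s" and "\<forall>e\<in>{1..d}. \<exists>l. Q e s l"
    by blast
  from bchoice[OF this(2)] obtain l where l: "\<And>e. e \<in> {1..d} \<Longrightarrow> Q e s (l e)"
    by blast
  have lV: "\<forall>e\<in>{1..d}. l e \<in> Vs e"
    using l by (simp add: Q_def)
  have "hnorm ip (tens l) = 1"
    unfolding hnorm_tens[OF lV] using l by (intro prod.neutral) (simp add: Q_def)
  then have lU: "tens l \<in> unit_pure"
    using lV by (auto simp: unit_pure_def pure_tensors_def)
  have "(\<lambda>n. ip (u (s n)) y) \<longlonglongrightarrow> ip (tens l) y" if "y \<in> V" for y
  proof (rule V.tendsto_ip_span)
    show "y \<in> V.span pure"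
      using that span_pure by simp
    show "(\<lambda>n. ip (u (s n)) b) \<longlonglongrightarrow> ip (tens l) b" if b_pure: "b \<in> pure" for b
    proof -
      obtain w where w: "\<forall>e\<in>{1..d}. w e \<in> Vs e" and b: "b = tens w"
        using b_pure by (auto simp: pure_tensors_def)
      have "(\<lambda>n. \<Prod>e=1..d. ips e (v (s n) e) (w e)) \<longlonglongrightarrow> (\<Prod>e=1..d. ips e (l e) (w e))"
        using l w by (intro tendsto_prod) (auto simp: Q_def)
      moreover have "ip (u n) b = (\<Prod>e=1..d. ips e (v n e) (w e))" for n
        unfolding u b using v(1) w by (intro ip_tens) auto
      ultimately show ?thesis
        using ip_tens[OF lV w] b by simp
    qed
  qed (use pure_in unit_pureD(2) assms lU in auto)
  with s lU show ?thesis
    by blast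
qed

section \<open>Attainment of the nuclear norm\<close>

text \<open>Weights and unit tensors are kept apart so that each can be confined to a compact set.
  Zero weights are allowed, so that shorter decompositions can be padded to length
  \<open>N\<close>.\<close>

definition unit_combination :: "'v \<Rightarrow> nat \<Rightarrow> (nat \<Rightarrow> real) \<Rightarrow> (nat \<Rightarrow> 'v) \<Rightarrow> bool" where
  "unit_combination T N c w \<longleftrightarrow> (\<forall>j<N. 0 \<le> c j \<and> w j \<in> unit_pure) \<and>
    T = (\<Sum>j<N. scaleV (of_real (c j)) (w j))"

text \<open>The bound \<open>C\<close> gives convergent subsequences of the weights, and
  \<open>unit_pure_seq_compact\<close> those of the tensors. The limit still represents
  \<open>T\<close>, because inner products determine a vector.\<close>

lemma compact_unit_combination:
  "compact ((\<lambda>(c, w). \<Sum>j<N. c j) ` {(c, w). unit_combination T N c w \<and> (\<forall>j<N. c j \<le> C)})"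
proof (rule compact_image_seq)
  fix p :: "nat \<Rightarrow> (nat \<Rightarrow> real) \<times> (nat \<Rightarrow> 'v)"
  assume p: "\<And>n. p n \<in> {(c, w). unit_combination T N c w \<and> (\<forall>j<N. c j \<le> C)}"
  define c where "c = (\<lambda>n. fst (p n))"
  define w where "w = (\<lambda>n. snd (p n))"
  have c: "\<And>n j. j < N \<Longrightarrow> 0 \<le> c n j" "\<And>n j. j < N \<Longrightarrow> c n j \<le> C"
    and w: "\<And>n j. j < N \<Longrightarrow> w n j \<in> unit_pure"
    and T: "\<And>n. T = (\<Sum>j<N. scaleV (of_real (c n j)) (w n j))"
    using p by (auto simp: unit_combination_def c_def w_def case_prod_beta)
  define Q where "Q = (\<lambda>j s (a :: real, l). (\<lambda>n::nat. c (s n) j) \<longlonglongrightarrow> a \<and> l \<in> unit_pure \<and>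
    (\<forall>y\<in>V. (\<lambda>n::nat. ip (w (s n) j) y) \<longlonglongrightarrow> ip l y))"
  have Q_subseq: "Q j (s \<circ> t) (a, l)" if "Q j s (a, l)" "strict_mono t" for j s t a l
    using that(1) unfolding Q_def comp_def case_prod_conv
    by (fast intro: LIMSEQ_subseq_LIMSEQ[OF _ that(2), unfolded comp_def])
  have "\<exists>s. strict_mono s \<and> (\<forall>j\<in>{..<N}. \<exists>q. Q j s q)"
  proof (rule finite_common_subseq)
    fix j and s :: "nat \<Rightarrow> nat"
    assume "j \<in> {..<N}"
    then have j: "j < N"
      by simp
    \<comment> \<open>The tensors are made to converge first; the weights are then refined along
      that subsequence.\<close>
    obtain l t where t: "strict_mono t" "l \<in> unit_pure"
      "\<forall>y\<in>V. (\<lambda>n. ip (w (s (t n)) j) y) \<longlonglongrightarrow> ip l y"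
      using unit_pure_seq_compact[of "\<lambda>n. w (s n) j"] w[OF j] by blast
    have "bounded (range (\<lambda>n. c (s (t n)) j))"
      using c[OF j] by (intro boundedI[of _ C]) auto
    then obtain a t' where t': "strict_mono t'" "(\<lambda>n. c (s (t (t' n))) j) \<longlonglongrightarrow> a"
      using bounded_imp_convergent_subsequence[of "\<lambda>n. c (s (t n)) j"] by (auto simp: o_def)
    have "Q j (s \<circ> (t \<circ> t')) (a, l)"
      using t t' LIMSEQ_subseq_LIMSEQ[OF _ t'(1)] unfolding Q_def comp_def case_prod_conv by fast
    then show "\<exists>t. strict_mono t \<and> (\<exists>q. Q j (s \<circ> t) q)"
      using strict_mono_o[OF t(1) t'(1)] by blast
  qed (use Q_subseq in \<open>force+\<close>)
  then obtain s where s: "strict_mono s" and "\<forall>j\<in>{..<N}. \<exists>q. Q j s q"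
    by blast
  from bchoice[OF this(2)] obtain q where q: "\<And>j. j < N \<Longrightarrow> Q j s (q j)"
    by auto
  define a where "a = (\<lambda>j. fst (q j))"
  define l where "l = (\<lambda>j. snd (q j))"
  have a: "\<And>j. j < N \<Longrightarrow> (\<lambda>n. c (s n) j) \<longlonglongrightarrow> a j"
    and l: "\<And>j. j < N \<Longrightarrow> l j \<in> unit_pure"
    and lim: "\<And>j y. j < N \<Longrightarrow> y \<in> V \<Longrightarrow> (\<lambda>n. ip (w (s n) j) y) \<longlonglongrightarrow> ip (l j) y"
    using q by (auto simp: Q_def a_def l_def case_prod_beta)
  have TV: "T \<in> V"
    unfolding T[of 0] using w unit_pureD(2) by (intro V.H_sum V.H_closed) auto
  have lV: "(\<Sum>j<N. scaleV (of_real (a j)) (l j)) \<in> V"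
    using l unit_pureD(2) by (intro V.H_sum V.H_closed) auto
  have "T = (\<Sum>j<N. scaleV (of_real (a j)) (l j))"
  proof (rule V.ip_eqI[OF TV lV])
    fix y assume y: "y \<in> V"
    \<comment> \<open>The left side does not depend on \<open>n\<close>, so uniqueness of limits
      identifies it with the limit of the right side.\<close>
    have "ip T y = (\<Sum>j<N. of_real (c (s n) j) * ip (w (s n) j) y)" for n
      by (subst T[of "s n"], rule V.ip_lincomb_left) (use w unit_pureD(2) y in auto)
    moreover have "(\<lambda>n. \<Sum>j<N. of_real (c (s n) j) * ip (w (s n) j) y)
        \<longlonglongrightarrow> (\<Sum>j<N. of_real (a j) * ip (l j) y)"
      using a lim y by (intro tendsto_intros) auto
    ultimately have "ip T y = (\<Sum>j<N. of_real (a j) * ip (l j) y)"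
      by (simp add: LIMSEQ_const_iff)
    also have "\<dots> = ip (\<Sum>j<N. scaleV (of_real (a j)) (l j)) y"
      by (rule V.ip_lincomb_left[symmetric]) (use l unit_pureD(2) y in auto)
    finally show "ip T y = ip (\<Sum>j<N. scaleV (of_real (a j)) (l j)) y" .
  qed
  moreover have "0 \<le> a j" "a j \<le> C" if "j < N" for j
    using a[OF that] c[OF that] by (auto intro: LIMSEQ_le_const LIMSEQ_le_const2)
  ultimately have "(a, l) \<in> {(c, w). unit_combination T N c w \<and> (\<forall>j<N. c j \<le> C)}"
    using l by (simp add: unit_combination_def)
  moreover have "(\<lambda>n. \<Sum>j<N. c (s n) j) \<longlonglongrightarrow> (\<Sum>j<N. a j)"
    using a by (intro tendsto_sum) auto
  then have "(\<lambda>n. (\<lambda>(c, w). \<Sum>j<N. c j) (p (s n))) \<longlonglongrightarrow> (\<lambda>(c, w). \<Sum>j<N. c j) (a, l)"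
    by (simp add: c_def case_prod_beta)
  ultimately show "\<exists>s l. strict_mono s \<and>
      l \<in> {(c, w). unit_combination T N c w \<and> (\<forall>j<N. c j \<le> C)} \<and>
      (\<lambda>n. (\<lambda>(c, w). \<Sum>j<N. c j) (p (s n))) \<longlonglongrightarrow> (\<lambda>(c, w). \<Sum>j<N. c j) l"
    using s by blast
qed

text \<open>The coefficients of an element of the span disappear into the pure tensors by
  \<open>pure_scale\<close>. Hence the nuclear norm minimizes over a nonempty set.\<close>

lemma pure_decomposition:
  assumes "T \<in> V"
  shows "\<exists>m u. (\<forall>i\<in>{1..m::nat}. u i \<in> pure) \<and> T = (\<Sum>i=1..m. u i)"
proof -
  have "T \<in> V.span pure"
    using assms span_pure by simp
  then show ?thesis
  proof (induction rule: V.span_induct_alt)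
    case base
    then show ?case by (intro exI[of _ 0]) simp
  next
    case (step c b y)
    then obtain m u where u: "\<forall>i\<in>{1..m::nat}. u i \<in> pure" "y = (\<Sum>i=1..m. u i)"
      by blast
    have "(\<Sum>i=1..m. (u(Suc m := scaleV c b)) i) = y"
      unfolding u(2) by (intro sum.cong) auto
    then show ?case
      using u(1) pure_scale[OF step.hyps(1)]
      by (intro exI[of _ "Suc m"] exI[of _ "u(Suc m := scaleV c b)"]) (auto simp: add.commute)
  qed
qed

text \<open>Zero summands are dropped, and every other one is its norm times a unit pure tensor.
  Repeated unit tensors are merged, since \<open>conic_caratheodory\<close> has its sums run over a
  set of vectors.\<close>

lemma normalize_decomposition:
  assumes "finite I" and "\<And>i. i \<in> I \<Longrightarrow> u i \<in> pure"
  shows "\<exists>X f. finite X \<and> X \<subseteq> unit_pure \<and> (\<forall>x\<in>X. 0 \<le> f x) \<and>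
    (\<Sum>i\<in>I. u i) = (\<Sum>x\<in>X. scaleV (of_real (f x)) x) \<and> sum f X = (\<Sum>i\<in>I. hnorm ip (u i))"
proof -
  define J where "J = {i \<in> I. u i \<noteq> 0}"
  define h where "h = (\<lambda>i. hnorm ip (u i))"
  define g where "g = (\<lambda>i. scaleV (1 / of_real (h i)) (u i))"
  \<comment> \<open>The weight of \<open>x\<close> collects the norms of all summands that normalize
    to \<open>x\<close>.\<close>
  define f where "f = (\<lambda>x. sum h {i \<in> J. g i = x})"
  have J: "finite J" "\<And>i. i \<in> J \<Longrightarrow> u i \<in> pure"
    using assms by (auto simp: J_def)
  have h: "h i > 0" if "i \<in> J" for i
    using that assms(2) pure_in V.hnorm_pos by (auto simp: J_def h_def)
  have g: "g i \<in> unit_pure" if "i \<in> J" for i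
    using that J(2) h[OF that] pure_scale pure_in
    by (auto simp: unit_pure_def g_def h_def V.hnorm_scale norm_divide)
  have hg: "scaleV (of_real (h i)) (g i) = u i" if "i \<in> J" for i
    using h[OF that] by (simp add: g_def)
  have "(\<Sum>i\<in>I. u i) = (\<Sum>i\<in>J. scaleV (of_real (h i)) (g i))"
    using assms(1) by (auto simp: J_def hg intro!: sum.mono_neutral_cong_right)
  also have "\<dots> = (\<Sum>x\<in>g ` J. \<Sum>i\<in>{i \<in> J. g i = x}. scaleV (of_real (h i)) (g i))"
    using J(1) by (rule sum.image_gen)
  also have "\<dots> = (\<Sum>x\<in>g ` J. scaleV (of_real (f x)) x)"
    by (intro sum.cong refl) (simp add: f_def V.scale_sum_left)
  finally have "(\<Sum>i\<in>I. u i) = (\<Sum>x\<in>g ` J. scaleV (of_real (f x)) x)" .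
  moreover have "(\<Sum>i\<in>I. h i) = sum h J"
    using assms(1) by (auto simp: J_def h_def V.hnorm_zero intro!: sum.mono_neutral_right)
  then have "sum f (g ` J) = (\<Sum>i\<in>I. h i)"
    using sum.image_gen[OF J(1), of h g] by (simp add: f_def)
  moreover have "\<forall>x\<in>g ` J. 0 \<le> f x"
    unfolding f_def using h by (intro ballI sum_nonneg) (auto intro: less_imp_le)
  ultimately show ?thesis
    using J(1) g by (intro exI[of _ "g ` J"] exI[of _ f]) (auto simp: h_def)
qed

text \<open>\<open>N\<close> is the size of a real spanning set of \<open>V\<close>, hence
  independent of the decomposition. Caratheodory reduction shortens to this length without raising
  the total weight.\<close>

lemma bounded_length_decomposition:
  assumes "T \<noteq> 0"
  shows "\<exists>N. \<forall>(m::nat) u. (\<forall>i\<in>{1..m}. u i \<in> pure) \<longrightarrow> T = (\<Sum>i=1..m. u i) \<longrightarrow>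
    (\<exists>c w. unit_combination T N c w \<and> (\<Sum>j<N. c j) \<le> (\<Sum>i=1..m. hnorm ip (u i)))"
proof -
  obtain B0 where B0: "finite B0" "V.span B0 = V"
    using V.finite_dim by blast
  define B where "B = B0 \<union> scaleV \<i> ` B0"
  define sc where "sc = (\<lambda>t::real. scaleV (of_real t))"
  have B: "finite B" "vector_space sc" "V \<subseteq> module.span sc B"
    using V.real_span[OF B0] B0(1) by (auto simp: B_def sc_def)
  have "\<exists>c w. unit_combination T (card B) c w \<and>
      (\<Sum>j<card B. c j) \<le> (\<Sum>i=1..m. hnorm ip (u i))"
    if u: "\<forall>i\<in>{1..m}. u i \<in> pure" and T: "T = (\<Sum>i=1..m. u i)" for m :: nat and u
  proof -
    have "\<exists>X f. finite X \<and> X \<subseteq> unit_pure \<and> (\<forall>x\<in>X. 0 \<le> f x) \<and>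
        T = (\<Sum>x\<in>X. sc (f x) x) \<and> sum f X = (\<Sum>i=1..m. hnorm ip (u i))"
      unfolding T sc_def using u by (intro normalize_decomposition) auto
    then obtain X f where X: "finite X" "X \<subseteq> unit_pure" "\<And>x. x \<in> X \<Longrightarrow> 0 \<le> f x"
      "T = (\<Sum>x\<in>X. sc (f x) x)" "sum f X = (\<Sum>i=1..m. hnorm ip (u i))"
      by blast
    have "X \<subseteq> module.span sc B"
      using X(2) unit_pureD(2) B(3) by blast
    then have "\<exists>Y g. Y \<subseteq> X \<and> card Y \<le> card B \<and> (\<forall>y\<in>Y. 0 \<le> g y) \<and>
        (\<Sum>y\<in>Y. sc (g y) y) = (\<Sum>x\<in>X. sc (f x) x) \<and> sum g Y \<le> sum f X"
      using X(3) by (intro conic_caratheodory B X(1))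
    then obtain Y g where "Y \<subseteq> X \<and> card Y \<le> card B \<and> (\<forall>y\<in>Y. 0 \<le> g y) \<and>
        (\<Sum>y\<in>Y. sc (g y) y) = (\<Sum>x\<in>X. sc (f x) x) \<and> sum g Y \<le> sum f X"
      by (elim exE)
    then have Y: "Y \<subseteq> X" "card Y \<le> card B" "\<And>y. y \<in> Y \<Longrightarrow> 0 \<le> g y"
      "T = (\<Sum>y\<in>Y. sc (g y) y)" "sum g Y \<le> sum f X"
      using X(4) by simp_all
    \<comment> \<open>Since \<open>T\<close> is nonzero, \<open>Y\<close> supplies a unit tensor
      \<open>y0\<close> with which, at weight 0, the indices from \<open>card Y\<close> on are
      filled.\<close>
    have "Y \<noteq> {}"
      using assms Y(4) by auto
    then obtain y0 where y0: "y0 \<in> Y"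
      by blast
    obtain k where k: "bij_betw k {..<card Y} Y"
      using ex_bij_betw_nat_finite[of Y] finite_subset[OF Y(1) X(1)] by (auto simp: lessThan_atLeast0)
    define c where "c = (\<lambda>j. if j < card Y then g (k j) else 0)"
    define w where "w = (\<lambda>j. if j < card Y then k j else y0)"
    have kY: "k j \<in> Y" if "j < card Y" for j
      using k that by (auto simp: bij_betw_def)
    have "(\<Sum>j<card B. scaleV (of_real (c j)) (w j)) = (\<Sum>j<card Y. sc (g (k j)) (k j))"
      using Y(2) by (intro sum.mono_neutral_cong_right) (auto simp: c_def w_def sc_def)
    also have "\<dots> = T"
      unfolding Y(4) using k by (rule sum.reindex_bij_betw)
    finally have "unit_combination T (card B) c w"
      using Y X(2) kY y0 by (auto simp: unit_combination_def c_def w_def)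
    moreover have "(\<Sum>j<card B. c j) = (\<Sum>j<card Y. g (k j))"
      using Y(2) by (intro sum.mono_neutral_cong_right) (auto simp: c_def)
    then have "(\<Sum>j<card B. c j) = sum g Y"
      using sum.reindex_bij_betw[OF k, of g] by simp
    ultimately show ?thesis
      using Y(5) X(5) by auto
  qed
  then show ?thesis
    by blast
qed

text \<open>Decompositions may be taken of one fixed length \<open>N\<close>. Only those costing at
  most \<open>C\<close>, the cost of one known combination, can compete, and among these compactness
  provides a minimum.\<close>

lemma nuclear_norm_attained:
  assumes "T \<in> V" and "T \<noteq> 0"
  shows "\<exists>N c w. unit_combination T N c w \<and> nuclear_norm ip d Vs tens T = (\<Sum>j<N. c j)"
proof -
  obtain N where N: "\<And>(m::nat) u. \<forall>i\<in>{1..m}. u i \<in> pure \<Longrightarrow> T = (\<Sum>i=1..m. u i) \<Longrightarrow>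
      \<exists>c w. unit_combination T N c w \<and> (\<Sum>j<N. c j) \<le> (\<Sum>i=1..m. hnorm ip (u i))"
    using bounded_length_decomposition[OF assms(2)] by blast
  obtain m u where "\<forall>i\<in>{1..m::nat}. u i \<in> pure" "T = (\<Sum>i=1..m. u i)"
    using pure_decomposition[OF assms(1)] by blast
  from N[OF this] obtain c0 w0 where cw0: "unit_combination T N c0 w0"
    by blast
  define C where "C = (\<Sum>j<N. c0 j)"
  define D where "D = {(c, w). unit_combination T N c w \<and> (\<forall>j<N. c j \<le> C)}"
  \<comment> \<open>Nonnegative weights are each bounded by their sum, so a total of at most
    \<open>C\<close> suffices for membership in \<open>D\<close>.\<close>
  have D_I: "(c, w) \<in> D" if cw: "unit_combination T N c w" and le: "(\<Sum>j<N. c j) \<le> C" for c w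
  proof -
    have "c j \<le> (\<Sum>j<N. c j)" if "j < N" for j
      using cw that by (intro member_le_sum) (auto simp: unit_combination_def)
    with cw le show ?thesis
      by (fastforce simp: D_def)
  qed
  have "compact ((\<lambda>(c, w). \<Sum>j<N. c j) ` D)"
    unfolding D_def by (rule compact_unit_combination)
  moreover have in_D: "(c0, w0) \<in> D"
    using cw0 by (intro D_I) (auto simp: C_def)
  ultimately obtain z where z: "z \<in> D"
    and "\<forall>y\<in>(\<lambda>(c, w). \<Sum>j<N. c j) ` D. (\<lambda>(c, w). \<Sum>j<N. c j) z \<le> y"
    using compact_attains_inf[of "(\<lambda>(c, w). \<Sum>j<N. c j) ` D"] by blast
  moreover obtain c w where "z = (c, w)"
    by fastforce
  ultimately have cw: "unit_combination T N c w"
    and min: "\<And>c' w'. (c', w') \<in> D \<Longrightarrow> (\<Sum>j<N. c j) \<le> (\<Sum>j<N. c' j)"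
    by (auto simp: D_def)
  have "nuclear_norm ip d Vs tens T = (\<Sum>j<N. c j)"
    unfolding nuclear_norm_def
  proof (rule Least_equality)
    \<comment> \<open>Combinations are indexed from 0, decompositions in \<open>nuclear_norm\<close>
      from 1.\<close>
    let ?u = "\<lambda>i. scaleV (of_real (c (i - 1))) (w (i - 1))"
    have "\<forall>i\<in>{1..N}. ?u i \<in> pure"
      using cw unit_pureD(1) pure_scale by (auto simp: unit_combination_def)
    moreover have "T = (\<Sum>i=1..N. ?u i)"
      using cw by (simp add: unit_combination_def sum.atLeast1_atMost_eq)
    moreover have "hnorm ip (scaleV (of_real (c j)) (w j)) = c j" if "j < N" for j
      using cw that unit_pureD by (auto simp: unit_combination_def V.hnorm_scale)
    then have "(\<Sum>j<N. c j) = (\<Sum>i=1..N. hnorm ip (?u i))"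
      by (simp add: sum.atLeast1_atMost_eq)
    ultimately show "\<exists>m u. (\<forall>i\<in>{1..m::nat}. u i \<in> pure) \<and> T = (\<Sum>i=1..m. u i) \<and>
        (\<Sum>j<N. c j) = (\<Sum>i=1..m. hnorm ip (u i))"
      by (intro exI[of _ N] exI[of _ ?u] conjI)
  next
    fix y
    assume "\<exists>m u. (\<forall>i\<in>{1..m::nat}. u i \<in> pure) \<and> T = (\<Sum>i=1..m. u i) \<and>
        y = (\<Sum>i=1..m. hnorm ip (u i))"
    then obtain c' w' where c': "unit_combination T N c' w'" "(\<Sum>j<N. c' j) \<le> y"
      using N by blast
    show "(\<Sum>j<N. c j) \<le> y"
    \<comment> \<open>A cost above \<open>C\<close> is already beaten by the starting combination
      \<open>(c0, w0)\<close>.\<close>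
    proof (cases "y \<le> C")
      case True
      then have "(c', w') \<in> D"
        using c' by (intro D_I) auto
      from min[OF this] c'(2) show ?thesis
        by simp
    next
      case False
      then show ?thesis
        using min[OF in_D] by (simp add: C_def)
    qed
  qed
  with cw show ?thesis
    by blast
qed

text \<open>The empty decomposition attains the lower bound 0. This covers the case excluded from
  \<open>nuclear_norm_attained\<close>.\<close>

lemma nuclear_norm_zero: "nuclear_norm ip d Vs tens 0 = 0"
  unfolding nuclear_norm_def
proof (rule Least_equality)
  show "\<exists>m u. (\<forall>i\<in>{1..m::nat}. u i \<in> pure) \<and> 0 = (\<Sum>i=1..m. u i) \<and>
      0 = (\<Sum>i=1..m. hnorm ip (u i))"
    by (intro exI[of _ 0]) simp
  show "0 \<le> y" if "\<exists>m u. (\<forall>i\<in>{1..m::nat}. u i \<in> pure) \<and> 0 = (\<Sum>i=1..m. u i) \<and>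
      y = (\<Sum>i=1..m. hnorm ip (u i))" for y
    using that V.hnorm_nonneg pure_in by (auto intro!: sum_nonneg)
qed

section \<open>Attainment of \<open>[S]\<^sub>\<alpha>\<close>\<close>

text \<open>The given \<open>u\<close> makes \<open>unit_pure\<close> nonempty, so the compact set
  of values has a maximum and \<open>GREATEST\<close> returns it.\<close>

lemma alpha_bracket_upper:
  assumes S: "\<forall>i\<in>{1..r}. S i \<in> V" and "\<alpha> \<ge> 1" and u: "u \<in> unit_pure"
  shows "(\<Sum>i=1..r. cmod (ip (S i) u) powr \<alpha>) powr (1 / \<alpha>) \<le> alpha_bracket ip d Vs tens r S \<alpha>"
proof -
  define G where "G = (\<lambda>u. (\<Sum>i=1..r. cmod (ip (S i) u) powr \<alpha>) powr (1 / \<alpha>))"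
  have "compact (G ` unit_pure)"
  proof (rule compact_image_seq)
    fix x :: "nat \<Rightarrow> 'v"
    assume x: "\<And>n. x n \<in> unit_pure"
    obtain s l where s: "strict_mono (s :: nat \<Rightarrow> nat)" "l \<in> unit_pure"
      and lim: "\<forall>y\<in>V. (\<lambda>n. ip (x (s n)) y) \<longlonglongrightarrow> ip l y"
      using unit_pure_seq_compact[of x] x by blast
    \<comment> \<open>Convergence is known in the left argument, whereas the bracket has
      \<open>u\<close> on the right.\<close>
    have flip: "ip (S i) v = cnj (ip v (S i))" if "i \<in> {1..r}" "v \<in> unit_pure" for i v
      using that S unit_pureD(2) by (intro V.ip_cnj) auto
    have "(\<lambda>n. ip (S i) (x (s n))) \<longlonglongrightarrow> ip (S i) l" if "i \<in> {1..r}" for i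
      using that s(2) x lim S by (simp add: flip lim_cnj)
    then have "(\<lambda>n. G (x (s n))) \<longlonglongrightarrow> G l"
      unfolding G_def using assms(2)
      \<comment> \<open>The base may tend to 0; the powers stay continuous there because the
        exponents are positive and the bases nonnegative.\<close>
      by (intro tendsto_powr' tendsto_sum tendsto_norm tendsto_const)
        (auto intro!: sum_nonneg always_eventually)
    with s show "\<exists>s l. strict_mono s \<and> l \<in> unit_pure \<and> (\<lambda>n. G (x (s n))) \<longlonglongrightarrow> G l"
      by blast
  qed
  then obtain v where v: "v \<in> unit_pure" "\<And>u. u \<in> unit_pure \<Longrightarrow> G u \<le> G v"
    using compact_attains_sup[of "G ` unit_pure"] u by blast
  have "alpha_bracket ip d Vs tens r S \<alpha> = G v"
    unfolding alpha_bracket_def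
    by (rule Greatest_equality) (use v in \<open>auto simp: unit_pure_def G_def\<close>)
  with v(2)[OF u] show ?thesis
    by (simp add: G_def)
qed

end

section \<open>Weighted sums in the p-norm\<close>

text \<open>For positive arguments this is \<open>powr_convex\<close>. If one argument is 0, what
  remains is \<open>t powr p \<le> t\<close> for \<open>0 < t < 1\<close>.\<close>

lemma convex_on_powr_nonneg:
  assumes "p \<ge> 1"
  shows "convex_on {0..} (\<lambda>x::real. x powr p)"
proof (rule convex_onI)
  fix t x y :: real
  assume t: "0 < t" "t < 1" and xy: "x \<in> {0..}" "y \<in> {0..}"
  have end0: "(t * x) powr p \<le> t * x powr p" if "0 < t" "t < 1" "0 \<le> x" for t x
    using that assms powr_mono'[of 1 p t] by (auto simp: powr_mult intro!: mult_right_mono)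
  show "((1 - t) *\<^sub>R x + t *\<^sub>R y) powr p \<le> (1 - t) * x powr p + t * y powr p"
  proof (cases "x = 0 \<or> y = 0")
    case True
    then show ?thesis
      using end0[of t y] end0[of "1 - t" x] t xy assms by auto
  next
    case False
    then show ?thesis
      using convex_onD[OF powr_convex[OF assms], of t x y] t xy by simp
  qed
qed simp

text \<open>Jensen with the convex weights \<open>c j / C\<close> bounds each \<open>p\<close>-th
  power. Interchanging the sums then leaves an average of the column sums, each at most
  \<open>K powr p\<close>.\<close>

lemma lp_norm_combination_le:
  fixes z :: "'i \<Rightarrow> 'j \<Rightarrow> complex"
  assumes "finite J" and c: "\<And>j. j \<in> J \<Longrightarrow> 0 \<le> c j" and "p \<ge> 1" and "0 \<le> K"
    and K: "\<And>j. j \<in> J \<Longrightarrow> (\<Sum>i\<in>I. cmod (z i j) powr p) powr (1 / p) \<le> K"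
  shows "(\<Sum>i\<in>I. cmod (\<Sum>j\<in>J. of_real (c j) * z i j) powr p) powr (1 / p) \<le> sum c J * K"
\<comment> \<open>With total weight 0 the weights cannot be normalized, but then all of them
  vanish.\<close>
proof (cases "sum c J = 0")
  case True
  then have "c j = 0" if "j \<in> J" for j
    using that c assms(1) by (simp add: sum_nonneg_eq_0_iff)
  then show ?thesis
    using True assms(3) by simp
next
  case False
  define C where "C = sum c J"
  have C: "C > 0"
    using False c sum_nonneg[of J c] by (force simp: C_def)
  have J: "J \<noteq> {}"
    using False by auto
  have jensen: "cmod (\<Sum>j\<in>J. of_real (c j) * z i j) powr p
      \<le> C powr p * (\<Sum>j\<in>J. c j / C * cmod (z i j) powr p)" for i
  proof -
    have "cmod (\<Sum>j\<in>J. of_real (c j) * z i j) \<le> (\<Sum>j\<in>J. c j * cmod (z i j))"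
      using c by (intro order_trans[OF norm_sum] sum_mono) (simp add: norm_mult)
    also have "\<dots> = C * (\<Sum>j\<in>J. c j / C * cmod (z i j))"
      using C by (simp add: sum_distrib_left)
    finally have "cmod (\<Sum>j\<in>J. of_real (c j) * z i j) powr p
        \<le> (C * (\<Sum>j\<in>J. c j / C * cmod (z i j))) powr p"
      using assms(3) by (intro powr_mono2) auto
    also have "\<dots> = C powr p * (\<Sum>j\<in>J. c j / C * cmod (z i j)) powr p"
      using C c by (intro powr_mult)
    finally have le: "cmod (\<Sum>j\<in>J. of_real (c j) * z i j) powr p
        \<le> C powr p * (\<Sum>j\<in>J. c j / C * cmod (z i j)) powr p" .
    have "(\<Sum>j\<in>J. (c j / C) *\<^sub>R cmod (z i j)) powr p
        \<le> (\<Sum>j\<in>J. c j / C * cmod (z i j) powr p)"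
      using C c by (intro convex_on_sum[OF assms(1) J convex_on_powr_nonneg[OF assms(3)]])
        (auto simp: C_def simp flip: sum_divide_distrib)
    then have "C powr p * (\<Sum>j\<in>J. c j / C * cmod (z i j)) powr p
        \<le> C powr p * (\<Sum>j\<in>J. c j / C * cmod (z i j) powr p)"
      by (intro mult_left_mono) auto
    with le show ?thesis
      by (rule order_trans)
  qed
  have K': "(\<Sum>i\<in>I. cmod (z i j) powr p) \<le> K powr p" if "j \<in> J" for j
  proof -
    have "((\<Sum>i\<in>I. cmod (z i j) powr p) powr (1 / p)) powr p \<le> K powr p"
      using K[OF that] assms(3) by (intro powr_mono2) auto
    then show ?thesis
      using assms(3) by (simp add: powr_powr sum_nonneg)
  qed
  have "(\<Sum>i\<in>I. cmod (\<Sum>j\<in>J. of_real (c j) * z i j) powr p)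
      \<le> (\<Sum>i\<in>I. C powr p * (\<Sum>j\<in>J. c j / C * cmod (z i j) powr p))"
    by (intro sum_mono jensen)
  also have "\<dots> = C powr p * (\<Sum>j\<in>J. c j / C * (\<Sum>i\<in>I. cmod (z i j) powr p))"
    by (simp only: sum_distrib_left[symmetric] sum.swap[of _ J I])
  also have "\<dots> \<le> C powr p * (\<Sum>j\<in>J. c j / C * K powr p)"
    using C c K' by (intro mult_left_mono sum_mono) auto
  also have "(\<Sum>j\<in>J. c j / C * K powr p) = K powr p"
    using C by (simp add: C_def flip: sum_distrib_right sum_divide_distrib)
  also have "C powr p * K powr p = (C * K) powr p"
    by (simp add: powr_mult)
  finally have "(\<Sum>i\<in>I. cmod (\<Sum>j\<in>J. of_real (c j) * z i j) powr p) powr (1 / p)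
      \<le> ((C * K) powr p) powr (1 / p)"
    using assms(3) by (intro powr_mono2) (auto intro: sum_nonneg)
  also have "\<dots> = C * K"
    using C assms(3,4) by (simp add: powr_powr)
  finally show ?thesis
    by (simp add: C_def)
qed

theorem theorem1p1:
  fixes scaleV :: "complex \<Rightarrow> 'v::ab_group_add \<Rightarrow> 'v" and V :: "'v set"
    and ip :: "'v \<Rightarrow> 'v \<Rightarrow> complex"
    and d :: nat
    and scale :: "complex \<Rightarrow> 'a::ab_group_add \<Rightarrow> 'a" and Vs :: "nat \<Rightarrow> 'a set"
    and ips :: "nat \<Rightarrow> 'a \<Rightarrow> 'a \<Rightarrow> complex"
    and tens :: "(nat \<Rightarrow> 'a) \<Rightarrow> 'v"
    and T :: 'v and r :: nat and S :: "nat \<Rightarrow> 'v" and \<alpha> :: real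
  assumes "hilbert_tensor_product scaleV V ip d scale Vs ips tens"
    and "T \<in> V"
    and "\<forall>i\<in>{1..r}. S i \<in> V"
    and "\<alpha> \<ge> 1"
  shows "(\<Sum>i=1..r. cmod (ip T (S i)) powr \<alpha>) powr (1 / \<alpha>)
    \<le> nuclear_norm ip d Vs tens T * alpha_bracket ip d Vs tens r S \<alpha>"
proof -
  interpret hilbert_tensor_product scaleV V ip d scale Vs ips tens
    by (rule assms(1))
  show ?thesis
  \<comment> \<open>For \<open>T = 0\<close> both sides are 0 whatever value the bracket has, which
    includes the zero space, where that value is unspecified.\<close>
  proof (cases "T = 0")
    case True
    then show ?thesis
      using assms(3,4) by (simp add: nuclear_norm_zero V.ip_zero_left)
  next
    case False
    let ?K = "alpha_bracket ip d Vs tens r S \<alpha>"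
    obtain N c w where cw: "unit_combination T N c w"
      and nn: "nuclear_norm ip d Vs tens T = (\<Sum>j<N. c j)"
      using nuclear_norm_attained[OF assms(2) False] by blast
    have c: "\<And>j. j < N \<Longrightarrow> 0 \<le> c j" and w: "\<And>j. j < N \<Longrightarrow> w j \<in> unit_pure"
      using cw by (simp_all add: unit_combination_def)
    have T: "T = (\<Sum>j<N. scaleV (of_real (c j)) (w j))"
      using cw unfolding unit_combination_def by (rule conjunct2)
    \<comment> \<open>Expanding \<open>T\<close> puts \<open>w j\<close> on the left, while the
      bracket has it on the right; the moduli agree by conjugate symmetry.\<close>
    have "cmod (ip (w j) (S i)) = cmod (ip (S i) (w j))" if "j < N" "i \<in> {1..r}" for i j
      using V.ip_cnj[of "S i" "w j"] that w unit_pureD(2) assms(3) by simp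
    then have K: "(\<Sum>i=1..r. cmod (ip (w j) (S i)) powr \<alpha>) powr (1 / \<alpha>) \<le> ?K" if "j < N" for j
      using alpha_bracket_upper[OF assms(3,4) w[OF that]] that by simp
    \<comment> \<open>A nonempty combination contains a unit pure tensor, and the bound
      \<open>K\<close> at this tensor shows that the bracket is nonnegative.\<close>
    have "N > 0"
      using T False by (cases N) auto
    then have "0 \<le> ?K"
      using K[of 0] by (intro order_trans[OF powr_ge_zero])
    moreover have "ip T (S i) = (\<Sum>j<N. of_real (c j) * ip (w j) (S i))" if "i \<in> {1..r}" for i
      unfolding T using that w unit_pureD(2) assms(3) by (intro V.ip_lincomb_left) auto
    ultimately show ?thesis
      unfolding nn
      using lp_norm_combination_le[of "{..<N}" c \<alpha> ?K "\<lambda>i j. ip (w j) (S i)" "{1..r}"] c K assms(4)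
      by simp
  qed
qed

end
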